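(* Let $\mathcal{Z}$ be a finite state space with $|\mathcal{Z}|=N\ge 2$ and let $\mathcal{T}$ be a non-empty, compact and convex set of transition matrices on $\mathcal{Z}$ with separately specified rows. Let $\mathcal{T}^2$ be the set of all transition matrices $\Delta$ on $\mathcal{Z}^2=\mathcal{Z}\times\mathcal{Z}$ of the form $$\Delta\bigl((x,y),(x',y')\bigr)=T^y(x,x')\,S^x(y,y'),\qquad x,y,x',y'\in\mathcal{Z},$$ where $(T^y)_{y\in\mathcal{Z}}$ and $(S^x)_{x\in\mathcal{Z}}$ range over all families of elements of $\mathcal{T}$. Let $\mathrm{co}(\mathcal{T}^2)$ be the convex hull of $\mathcal{T}^2$, and let $D=\{(z,z): z\in\mathcal{Z}\}$. For all $(x,y)\in\mathcal{Z}^2$ let $$\overline{m}^{\mathcal{T}^2}(x,y):=\sup_{\Delta\in\mathcal{T}^2}\mathbb{E}_{\Delta}\bigl[\mu\mid (X_0,Y_0)=(x,y)\bigr]$$ be the upper expected meeting time. Then the supremum is unchanged if $\mathcal{T}^2$ is replaced by $\mathrm{co}(\mathcal{T}^2)$, and $\overline{m}^{\mathcal{T}^2}$ is the minimal non-negative solution $m:\mathcal{Z}^2\to[0,+\infty]$ of $$m=\mathbb{1}_{D^c}+\mathbb{1}_{D^c}\cdot\overline{\Delta}\,m,$$ that is, of $m(z,z)=0$ for all $z\in\mathcal{Z}$ and $m(x,y)=1+[\overline{\Delta}m](x,y)$ for all $x\neq y$.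
   Context: A transition matrix on a finite set is a row-stochastic matrix indexed by that set. $\mathcal{T}$ has separately specified rows if there are sets $\mathcal{T}_z$ ($z\in\mathcal{Z}$) of probability mass functions on $\mathcal{Z}$ such that $\mathcal{T}$ consists of exactly the transition matrices $T$ with $T(z,\cdot)\in\mathcal{T}_z$ for all $z$. $\mathbb{E}_\Delta$ is expectation for the homogeneous Markov chain $(X_n,Y_n)_{n\ge 0}$ on $\mathcal{Z}^2$ with transition matrix $\Delta$, and the meeting time is $\mu:=\inf\{n\ge 0: X_n=Y_n\}\in\{0,1,2,\dots\}\cup\{+\infty\}$. The upper transition operator is $[\overline{\Delta}f](x,y):=\sup_{\Delta\in\mathrm{co}(\mathcal{T}^2)}\sum_{(x',y')\in\mathcal{Z}^2}\Delta\bigl((x,y),(x',y')\bigr)f(x',y')$, applied also to functions $f:\mathcal{Z}^2\to[0,+\infty]$ with the convention $0\cdot(+\infty)=0$. "Minimal non-negative solution" means that it is a solution and is pointwise less than or equal to every other solution with values in $[0,+\infty]$. $\mathbb{1}_{D^c}$ is the indicator of $D^c=\mathcal{Z}^2\setminus D$ and $\cdot$ is the element-wise product. *)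

theory Defs
  imports "HOL-Probability.Probability"
begin

text \<open>Finite state spaces are types of class finite. The row of a matrix \<open>A\<close> at \<open>x\<close> is the
  vector \<open>A $ x\<close>, so \<open>A $ x $ x'\<close> is the probability of moving from \<open>x\<close> to \<open>x'\<close>.\<close>

definition prob_vector :: "real ^ 's::finite \<Rightarrow> bool" where
  "prob_vector p \<longleftrightarrow> (\<forall>s. 0 \<le> p $ s) \<and> (\<Sum>s\<in>UNIV. p $ s) = 1"

definition transition_matrix :: "real ^ 's ^ 's::finite \<Rightarrow> bool" where
  "transition_matrix A \<longleftrightarrow> (\<forall>s. prob_vector (A $ s))"

definition separately_specified_rows :: "(real ^ 's ^ 's::finite) set \<Rightarrow> bool" where
  "separately_specified_rows \<T> \<longleftrightarrow>
     (\<exists>R :: 's \<Rightarrow> (real ^ 's) set. (\<forall>z. R z \<subseteq> Collect prob_vector) \<and>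
        \<T> = {T. transition_matrix T \<and> (\<forall>z. T $ z \<in> R z)})"

definition pair_matrix ::
  "('z::finite \<Rightarrow> real ^ 'z ^ 'z) \<Rightarrow> ('z \<Rightarrow> real ^ 'z ^ 'z) \<Rightarrow> real ^ ('z \<times> 'z) ^ ('z \<times> 'z)" where
  "pair_matrix T S =
     (\<chi> w w'. T (snd w) $ fst w $ fst w' * S (fst w) $ snd w $ snd w')"

definition pair_set ::
  "(real ^ 'z ^ 'z::finite) set \<Rightarrow> (real ^ ('z \<times> 'z) ^ ('z \<times> 'z)) set" where
  "pair_set \<T> = {pair_matrix T S | T S. (\<forall>y. T y \<in> \<T>) \<and> (\<forall>x. S x \<in> \<T>)}"


subsection \<open>The homogeneous Markov chain of a transition matrix\<close>

definition row_pmf :: "real ^ 's ^ 's::finite \<Rightarrow> 's \<Rightarrow> 's pmf" where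
  "row_pmf A s = embed_pmf (\<lambda>s'. A $ s $ s')"

definition step_kernel :: "real ^ 's ^ 's::finite \<Rightarrow> 's \<Rightarrow> nat \<Rightarrow> (nat \<Rightarrow> 's) \<Rightarrow> 's measure" where
  "step_kernel A s n \<omega> =
     measure_pmf (case n of 0 \<Rightarrow> return_pmf s | Suc k \<Rightarrow> row_pmf A (\<omega> k))"

text \<open>The law of the chain on the space of trajectories, given by the Ionescu-Tulcea theorem.
  If \<open>A\<close> is not a transition matrix, the value is meaningless.
  The lemmas below show that it has the usual finite-dimensional distributions.\<close>

definition chain :: "real ^ 's ^ 's::finite \<Rightarrow> 's \<Rightarrow> (nat \<Rightarrow> 's) measure" where
  "chain A s = projective_family.lim UNIV
     (Ionescu_Tulcea.CI (step_kernel A s) (\<lambda>_. count_space UNIV)) (\<lambda>_. count_space UNIV)"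

definition meeting_time :: "(nat \<Rightarrow> 'z \<times> 'z) \<Rightarrow> enat" where
  "meeting_time \<omega> = Inf {enat n | n. fst (\<omega> n) = snd (\<omega> n)}"

definition expected_meeting_time ::
  "real ^ ('z \<times> 'z) ^ ('z \<times> 'z::finite) \<Rightarrow> 'z \<times> 'z \<Rightarrow> ennreal" where
  "expected_meeting_time \<Delta> w = (\<integral>\<^sup>+\<omega>. ennreal_of_enat (meeting_time \<omega>) \<partial>chain \<Delta> w)"

definition upper_expected_meeting_time ::
  "(real ^ ('z \<times> 'z) ^ ('z \<times> 'z::finite)) set \<Rightarrow> 'z \<times> 'z \<Rightarrow> ennreal" where
  "upper_expected_meeting_time \<D> w = (SUP \<Delta>\<in>\<D>. expected_meeting_time \<Delta> w)"


subsection \<open>The upper transition operator and the meeting time equation\<close>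

definition upper_transition_operator ::
  "(real ^ 's ^ 's::finite) set \<Rightarrow> ('s \<Rightarrow> ennreal) \<Rightarrow> 's \<Rightarrow> ennreal" where
  "upper_transition_operator \<D> f s = (SUP \<Delta>\<in>\<D>. \<Sum>s'\<in>UNIV. ennreal (\<Delta> $ s $ s') * f s')"

definition diagonal :: "('z \<times> 'z) set" where
  "diagonal = {(z, z) | z. True}"

definition meeting_equation ::
  "(real ^ 'z ^ 'z::finite) set \<Rightarrow> ('z \<times> 'z \<Rightarrow> ennreal) \<Rightarrow> bool" where
  "meeting_equation \<T> m \<longleftrightarrow>
     (\<forall>w. m w = indicator (- diagonal) w + indicator (- diagonal) w *
        upper_transition_operator (convex hull (pair_set \<T>)) m w)"


subsection \<open>Adequacy of the definitions\<close>

lemma meeting_equation_iff: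
  "meeting_equation \<T> m \<longleftrightarrow>
     (\<forall>z. m (z, z) = 0) \<and>
     (\<forall>x y. x \<noteq> y \<longrightarrow> m (x, y) = 1 + upper_transition_operator (convex hull (pair_set \<T>)) m (x, y))"
  by (auto simp: meeting_equation_def diagonal_def indicator_def)

lemma transition_matrix_pair_matrix:
  assumes "\<And>y. transition_matrix (T y)" and "\<And>x. transition_matrix (S x)"
  shows "transition_matrix (pair_matrix T S)"
proof -
  have 1: "(\<Sum>s'\<in>UNIV. T y $ x $ s') = 1" "0 \<le> T y $ x $ s"
          "(\<Sum>s'\<in>UNIV. S x $ y $ s') = 1" "0 \<le> S x $ y $ s" for x y s
    using assms by (auto simp: transition_matrix_def prob_vector_def)
  have "(\<Sum>w'\<in>UNIV. T y $ x $ fst w' * S x $ y $ snd w') = 1" for x y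
  proof -
    have "(\<Sum>w'\<in>UNIV. T y $ x $ fst w' * S x $ y $ snd w')
        = (\<Sum>a\<in>UNIV. \<Sum>b\<in>UNIV. T y $ x $ a * S x $ y $ b)"
      by (simp add: sum.cartesian_product case_prod_beta flip: UNIV_Times_UNIV)
    also have "\<dots> = (\<Sum>a\<in>UNIV. T y $ x $ a) * (\<Sum>b\<in>UNIV. S x $ y $ b)"
      by (simp add: sum_product)
    finally show ?thesis by (simp add: 1)
  qed
  then show ?thesis
    by (auto simp: transition_matrix_def prob_vector_def pair_matrix_def 1)
qed

lemma convex_transition_matrices:
  "convex {A :: real ^ 's ^ 's::finite. transition_matrix A}"
  by (auto simp: convex_def transition_matrix_def prob_vector_def sum.distrib
      simp flip: sum_distrib_left)

lemma transition_matrix_convex_hull_pair_set: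
  assumes "separately_specified_rows \<T>" and "\<Delta> \<in> convex hull (pair_set \<T>)"
  shows "transition_matrix \<Delta>"
proof -
  have "pair_set \<T> \<subseteq> {A. transition_matrix A}"
    using assms(1)
    by (auto simp: pair_set_def separately_specified_rows_def intro!: transition_matrix_pair_matrix)
  then show ?thesis
    using hull_minimal[of "pair_set \<T>" _ convex] convex_transition_matrices assms(2) by blast
qed

lemma pmf_row_pmf:
  assumes "transition_matrix A"
  shows "pmf (row_pmf A s) s' = A $ s $ s'"
proof -
  have "\<And>t. 0 \<le> A $ s $ t" and "(\<Sum>t\<in>UNIV. A $ s $ t) = 1"
    using assms by (auto simp: transition_matrix_def prob_vector_def)
  then show ?thesis
    unfolding row_pmf_def
    by (subst pmf_embed_pmf) (auto simp: nn_integral_count_space_finite sum_ennreal)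
qed

interpretation chain: Ionescu_Tulcea "step_kernel A s" "\<lambda>_. count_space UNIV"
  for A :: "real ^ 's ^ 's::finite" and s
proof (rule Ionescu_Tulcea.intro)
  fix n
  show "step_kernel A s n \<in> PiM {0..<n} (\<lambda>_. count_space UNIV) \<rightarrow>\<^sub>M subprob_algebra (count_space UNIV)"
  proof (cases n)
    case 0
    then show ?thesis
      by (simp add: step_kernel_def [abs_def] space_subprob_algebra measure_pmf.subprob_space_axioms)
  next
    case (Suc k)
    have "(\<lambda>\<omega>. \<omega> k) \<in> PiM {0..<n} (\<lambda>_. count_space UNIV) \<rightarrow>\<^sub>M (count_space UNIV :: 's measure)"
      using Suc by (intro measurable_component_singleton) auto
    moreover have "(\<lambda>t. measure_pmf (row_pmf A t)) \<in> count_space UNIV \<rightarrow>\<^sub>M subprob_algebra (count_space UNIV)"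
      by (auto simp: space_subprob_algebra measure_pmf.subprob_space_axioms)
    ultimately show ?thesis
      unfolding Suc step_kernel_def [abs_def] nat.case
      by (rule measurable_compose)
  qed
next
  show "prob_space (step_kernel A s n \<omega>)" for n \<omega>
    unfolding step_kernel_def by (rule measure_pmf.prob_space_axioms)
qed

lemma sets_chain: "sets (chain A s) = sets (PiM UNIV (\<lambda>_. count_space UNIV))"
  by (simp add: chain_def)

lemma space_chain: "space (chain A s) = UNIV"
  by (simp add: chain_def space_PiM)

lemma prob_space_chain: "prob_space (chain A s)"
proof
  let ?M = "\<lambda>_::nat. count_space UNIV :: 's measure"
  have "emeasure (chain A s) (prod_emb UNIV ?M {} (space (PiM {} ?M))) =
      emeasure (chain.CI A s {}) (space (PiM {} ?M))"
    unfolding chain_def by (rule chain.lim) auto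
  also have "\<dots> = 1"
    using prob_space.emeasure_space_1[OF chain.PF.prob_space_P, of "{}" A s]
      chain.PF.space_P[of "{}" A s] by simp
  finally show "emeasure (chain A s) (space (chain A s)) = 1"
    by (simp add: space_chain prod_emb_def space_PiM PiE_def extensional_def)
qed

lemma singleton_restrict_eq_PiE: "{restrict t J} = PiE J (\<lambda>i. {t i})"
proof -
  have "PiE J (\<lambda>i. {t i}) = PiE J (\<lambda>i. {restrict t J i})"
    by (rule PiE_cong) simp
  then show ?thesis
    using PiE_singleton[of "restrict t J" J] by simp
qed

lemma emeasure_chain_C:
  fixes A :: "real ^ 's ^ 's::finite"
  assumes "transition_matrix A"
  shows "emeasure (chain.C A s 0 (Suc n) (\<lambda>_. undefined)) {restrict t {0..<Suc n}} =
    (if t 0 = s then ennreal (\<Prod>i<n. A $ t i $ t (Suc i)) else 0)"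
proof -
  let ?M = "\<lambda>_::nat. count_space UNIV :: 's measure"
  let ?u = "\<lambda>_::nat. undefined :: 's"
  let ?C = "\<lambda>n. chain.C A s 0 n ?u"
  have u: "?u \<in> space (PiM {0..<0} ?M)"
    by (simp add: space_PiM)
  have meas: "{restrict t {0..<n}} \<in> sets (PiM {0..<n} ?M)" for n
  proof -
    have "{restrict t {0..<n}} = PiE {0..<n} (\<lambda>i. {t i})"
      by (rule singleton_restrict_eq_PiE)
    then show ?thesis
      by (simp only:) (rule sets_PiM_I_finite, auto)
  qed
  have step: "emeasure (?C (Suc n)) {restrict t {0..<Suc n}} =
      emeasure (?C n) {restrict t {0..<n}} * emeasure (step_kernel A s n (restrict t {0..<n})) {t n}"
    (is "_ = ?c * ?p") for n
  proof -
    have C: "space (?C n) = space (PiM {0..<n} ?M)" "sets (?C n) = sets (PiM {0..<n} ?M)"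
      using chain.space_C[OF u, of A s n] chain.sets_C[OF u, of A s n] by simp_all
    have ne: "space (?C n) \<noteq> {}"
      using C by (simp add: space_PiM PiE_eq_empty_iff)
    have "emeasure (?C (Suc n)) {restrict t {0..<Suc n}} =
        (\<integral>\<^sup>+x. emeasure (chain.eP A s n x) {restrict t {0..<Suc n}} \<partial>?C n)"
      unfolding chain.C.simps add_0
    proof (rule emeasure_bind[OF ne _ meas])
      show "chain.eP A s n \<in> ?C n \<rightarrow>\<^sub>M subprob_algebra (PiM {0..<Suc n} ?M)"
        using chain.measurable_eP[of A s n] measurable_cong_sets[OF C(2) refl] by blast
    qed
    also have "\<dots> = (\<integral>\<^sup>+x. ?p * indicator {restrict t {0..<n}} x \<partial>?C n)"
    proof (rule nn_integral_cong)
      fix x assume "x \<in> space (?C n)"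
      then have x: "x \<in> space (PiM {0..<n} ?M)"
        by (simp add: C)
      then have ext: "x \<in> extensional {0..<n}"
        by (simp add: space_PiM PiE_def)
      have eq: "x(n := y) = restrict t {0..<Suc n} \<longleftrightarrow> x = restrict t {0..<n} \<and> y = t n" for y
      proof
        assume *: "x(n := y) = restrict t {0..<Suc n}"
        have "x i = restrict t {0..<n} i" for i
          using fun_cong[OF *, of i] ext by (auto simp: extensional_def split: if_splits)
        then show "x = restrict t {0..<n} \<and> y = t n"
          using fun_cong[OF *, of n] by auto
      next
        assume "x = restrict t {0..<n} \<and> y = t n"
        then show "x(n := y) = restrict t {0..<Suc n}"
          by (auto simp: fun_eq_iff)
      qed
      have "emeasure (chain.eP A s n x) {restrict t {0..<Suc n}} =
          emeasure (step_kernel A s n x) {y. x(n := y) = restrict t {0..<Suc n}}"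
        by (subst chain.emeasure_eP[OF x meas]) (simp add: vimage_def)
      also have "\<dots> = ?p * indicator {restrict t {0..<n}} x"
        unfolding eq by (cases "x = restrict t {0..<n}") auto
      finally show "emeasure (chain.eP A s n x) {restrict t {0..<Suc n}} =
          ?p * indicator {restrict t {0..<n}} x" .
    qed
    also have "\<dots> = ?c * ?p"
      by (subst nn_integral_cmult_indicator) (auto simp: C meas mult.commute)
    finally show ?thesis .
  qed
  have nonneg: "0 \<le> A $ i $ j" for i j
    using assms by (auto simp: transition_matrix_def prob_vector_def)
  have kernel_Suc: "emeasure (step_kernel A s (Suc n) (restrict t {0..<Suc n})) {t (Suc n)} =
      ennreal (A $ t n $ t (Suc n))" for n
    by (simp add: step_kernel_def emeasure_pmf_single pmf_row_pmf[OF assms])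
  show ?thesis
  proof (induction n)
    case 0
    have "emeasure (?C 0) {restrict t {0..<0}} = 1"
      using meas[of 0] by (simp add: restrict_def)
    moreover have "emeasure (step_kernel A s 0 (restrict t {0..<0})) {t 0} = (if t 0 = s then 1 else 0)"
      by (simp add: step_kernel_def emeasure_pmf_single indicator_def)
    ultimately show ?case
      unfolding step by simp
  next
    case (Suc n)
    show ?case
      unfolding step[of "Suc n"] Suc.IH kernel_Suc
      by (simp add: ennreal_mult prod_nonneg nonneg)
  qed
qed

lemma emeasure_chain_cylinder:
  fixes A :: "real ^ 's ^ 's::finite"
  assumes "transition_matrix A"
  shows "emeasure (chain A s) {\<omega>. \<forall>i\<le>n. \<omega> i = t i} =
    (if t 0 = s then ennreal (\<Prod>i<n. A $ t i $ t (Suc i)) else 0)"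
proof -
  let ?M = "\<lambda>_::nat. count_space UNIV :: 's measure"
  let ?J = "{0..<Suc n}"
  have set_eq: "{restrict t ?J} = PiE ?J (\<lambda>i. {t i})"
    by (rule singleton_restrict_eq_PiE)
  have meas: "{restrict t ?J} \<in> sets (PiM ?J ?M)"
    unfolding set_eq by (rule sets_PiM_I_finite) auto
  have "{\<omega>. \<forall>i\<le>n. \<omega> i = t i} = prod_emb UNIV ?M ?J {restrict t ?J}"
    by (simp add: prod_emb_def restrict_def fun_eq_iff set_eq_iff less_Suc_eq_le)
  then have "emeasure (chain A s) {\<omega>. \<forall>i\<le>n. \<omega> i = t i} = emeasure (chain.CI A s ?J) {restrict t ?J}"
    unfolding chain_def using chain.lim[OF _ meas, of A s] by simp
  also have "\<dots> = emeasure (chain.C A s 0 (Suc n) (\<lambda>_. undefined)) (prod_emb ?J ?M ?J {restrict t ?J})"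
    by (rule chain.emeasure_CI[OF subset_refl meas])
  also have "prod_emb ?J ?M ?J {restrict t ?J} = {restrict t ?J}"
    by (rule prod_emb_id) (auto simp: space_PiM)
  finally show ?thesis
    by (simp only: emeasure_chain_C[OF assms])
qed

end

(* The fixed-point operator of the meeting time equation is sup-continuous, so its least fixed point
   u is the supremum of its iterates, and the expected meeting time of a single matrix is the least
   fixed point of the operator of that matrix. By monotonicity every expected meeting time is at
   most u. Conversely, iterates of the operator discounted by a factor b < 1 are finite
   subsolutions; any c with b < c < 1 leaves room to choose nearly optimal rows, simultaneously in
   all states, so one matrix of the separately specified set turns the subsolution into a lower
   bound for its own expected meeting time. Letting b tend to 1 yields u. Discounting keeps all
   quantities finite, so states with infinite upper expected meeting time need no special care. *)
theory Submission
  imports Defs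
begin

section \<open>The meeting time operator\<close>

text \<open>Right-hand side of the meeting equation with the set of matrices left as a parameter, so
  that the pair set, its convex hull and single matrices can be compared.\<close>

definition meeting_operator ::
  "(real ^ ('z \<times> 'z) ^ ('z \<times> 'z::finite)) set \<Rightarrow> ('z \<times> 'z \<Rightarrow> ennreal) \<Rightarrow> 'z \<times> 'z \<Rightarrow> ennreal" where
  "meeting_operator \<D> f w =
     indicator (- diagonal) w + indicator (- diagonal) w * upper_transition_operator \<D> f w"

lemma upper_transition_operator_mono:
  "\<D> \<subseteq> \<E> \<Longrightarrow> f \<le> g \<Longrightarrow> upper_transition_operator \<D> f s \<le> upper_transition_operator \<E> g s"
  unfolding upper_transition_operator_def
  by (intro SUP_subset_mono sum_mono mult_left_mono) (auto dest: le_funD)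

lemma meeting_operator_mono:
  "\<D> \<subseteq> \<E> \<Longrightarrow> f \<le> g \<Longrightarrow> meeting_operator \<D> f \<le> meeting_operator \<E> g"
  unfolding meeting_operator_def
  by (intro le_funI add_left_mono mult_left_mono upper_transition_operator_mono)
    (simp_all add: le_funD)

lemma mono_meeting_operator: "mono (meeting_operator \<D>)"
  by (intro monoI meeting_operator_mono order_refl)

lemma transition_matrix_nonneg: "transition_matrix A \<Longrightarrow> 0 \<le> A $ s $ s'"
  unfolding transition_matrix_def prob_vector_def by blast

lemma transition_matrix_row_sum:
  assumes "transition_matrix A"
  shows "(\<Sum>s'\<in>UNIV. ennreal (A $ s $ s')) = 1"
proof -
  have "(\<Sum>s'\<in>UNIV. A $ s $ s') = 1"
    using assms unfolding transition_matrix_def prob_vector_def by blast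
  then show ?thesis
    by (simp add: sum_ennreal transition_matrix_nonneg[OF assms])
qed

lemma upper_transition_operator_le_const:
  assumes tm: "\<And>\<Delta>. \<Delta> \<in> \<D> \<Longrightarrow> transition_matrix \<Delta>" and f: "\<And>s. f s \<le> c"
  shows "upper_transition_operator \<D> f s \<le> c"
  unfolding upper_transition_operator_def
proof (rule SUP_least)
  fix \<Delta> assume "\<Delta> \<in> \<D>"
  have "(\<Sum>s'\<in>UNIV. ennreal (\<Delta> $ s $ s') * f s') \<le> (\<Sum>s'\<in>UNIV. ennreal (\<Delta> $ s $ s') * c)"
    by (intro sum_mono mult_left_mono f) simp
  also have "\<dots> = c"
    by (simp add: transition_matrix_row_sum[OF tm[OF \<open>\<Delta> \<in> \<D>\<close>]] flip: sum_distrib_right)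
  finally show "(\<Sum>s'\<in>UNIV. ennreal (\<Delta> $ s $ s') * f s') \<le> c" .
qed

lemma upper_transition_operator_singleton:
  "upper_transition_operator {A} f s = (\<Sum>s'\<in>UNIV. ennreal (A $ s $ s') * f s')"
  by (simp add: upper_transition_operator_def)

lemma upper_transition_operator_cmult:
  "upper_transition_operator \<D> (\<lambda>x. c * f x) s = c * upper_transition_operator \<D> f s"
  unfolding upper_transition_operator_def SUP_mult_left_ennreal
  by (simp add: sum_distrib_left mult.left_commute)

lemma sup_continuous_sum_ennreal:
  fixes f :: "'i \<Rightarrow> 'a :: complete_lattice \<Rightarrow> ennreal"
  assumes "\<And>i. i \<in> I \<Longrightarrow> sup_continuous (f i)"
  shows "sup_continuous (\<lambda>x. \<Sum>i\<in>I. f i x)"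
  using assms
  by (induction I rule: infinite_finite_induct) (auto intro!: order_continuous_intros)

text \<open>The supremum over \<open>\<D>\<close>, finite sums and multiplication in
  \<open>ennreal\<close> all commute with suprema of increasing sequences. Hence the least fixed
  point is reached by countably many iterations from \<open>bot\<close>.\<close>

lemma sup_continuous_meeting_operator: "sup_continuous (meeting_operator \<D>)"
  unfolding meeting_operator_def[abs_def] upper_transition_operator_def
  by (intro order_continuous_intros sup_continuous_sum_ennreal)

text \<open>For fixed \<open>f\<close> and \<open>s\<close> the objective is affine in the matrix,
  so its upper level bound cuts out a convex set containing \<open>\<D>\<close> and therefore its
  hull.\<close>

lemma upper_transition_operator_convex_hull:
  assumes "\<And>\<Delta>. \<Delta> \<in> \<D> \<Longrightarrow> transition_matrix \<Delta>"
  shows "upper_transition_operator (convex hull \<D>) f s = upper_transition_operator \<D> f s"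
proof (rule antisym)
  let ?c = "upper_transition_operator \<D> f s"
  \<comment> \<open>Nonnegativity is part of the set because \<open>ennreal\<close> sends negative
    reals to 0 and is additive only on nonnegative ones.\<close>
  let ?S = "{\<Delta>. (\<forall>s'. 0 \<le> \<Delta> $ s $ s') \<and> (\<Sum>s'\<in>UNIV. ennreal (\<Delta> $ s $ s') * f s') \<le> ?c}"
  have "\<D> \<subseteq> ?S"
    using transition_matrix_nonneg[OF assms] unfolding upper_transition_operator_def
    by (auto intro: SUP_upper)
  moreover have "convex ?S"
  proof (rule convexI)
    fix A B :: "real ^ _ ^ _" and u v :: real
    assume AB: "A \<in> ?S" "B \<in> ?S" and uv: "0 \<le> u" "0 \<le> v" "u + v = 1"
    have "(\<Sum>s'\<in>UNIV. ennreal ((u *\<^sub>R A + v *\<^sub>R B) $ s $ s') * f s') =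
        ennreal u * (\<Sum>s'\<in>UNIV. ennreal (A $ s $ s') * f s') +
        ennreal v * (\<Sum>s'\<in>UNIV. ennreal (B $ s $ s') * f s')"
      using AB uv
      by (simp add: ennreal_plus ennreal_mult distrib_right sum.distrib sum_distrib_left mult.assoc)
    also have "\<dots> \<le> ennreal u * ?c + ennreal v * ?c"
      using AB by (intro add_mono mult_left_mono) auto
    also have "\<dots> = ?c"
      using uv by (simp flip: distrib_right ennreal_plus)
    finally show "u *\<^sub>R A + v *\<^sub>R B \<in> ?S"
      using AB uv by simp
  qed
  ultimately have "convex hull \<D> \<subseteq> ?S"
    by (rule hull_minimal)
  then show "upper_transition_operator (convex hull \<D>) f s \<le> ?c"
    unfolding upper_transition_operator_def[of "convex hull \<D>"] by (intro SUP_least) auto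
qed (intro upper_transition_operator_mono hull_subset order_refl)


section \<open>Expected meeting time of a Markov chain\<close>

lemma sets_chain_Collect:
  "Measurable.pred (chain A s) P \<Longrightarrow> {\<omega>. P \<omega>} \<in> sets (chain A s)"
  by (simp add: pred_def space_chain)

lemma pred_chain_coordinate: "Measurable.pred (chain A s) (\<lambda>\<omega>. \<omega> i \<in> B)"
proof -
  have "(\<lambda>\<omega>. \<omega> i) \<in> chain A s \<rightarrow>\<^sub>M count_space UNIV"
    unfolding measurable_cong_sets[OF sets_chain refl]
    by (rule measurable_component_singleton) simp
  then show ?thesis
    by (rule measurable_compose) simp
qed

lemmas sets_chain_intros = sets_chain_Collect pred_intros_logic(3) pred_intros_imp' pred_intros_countable(1)
  pred_chain_coordinate pred_chain_coordinate[where B = "{x}" for x, unfolded singleton_iff]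

text \<open>First-step recursion for the probability that the chain started in \<open>s\<close> lies
  in \<open>B\<close> at all times 0 to \<open>n\<close>, both ends included.\<close>

primrec stay_prob :: "real ^ 's ^ 's::finite \<Rightarrow> 's set \<Rightarrow> nat \<Rightarrow> 's \<Rightarrow> ennreal" where
  "stay_prob A B 0 s = indicator B s"
| "stay_prob A B (Suc n) s =
     indicator B s * (\<Sum>s'\<in>UNIV. ennreal (A $ s $ s') * stay_prob A B n s')"

text \<open>Markov property in product form, which covers null cylinders too. The induction splits
  on the state at time \<open>Suc k\<close> and moves it into the cylinder, hence the arbitrary
  \<open>k\<close> and \<open>t\<close>. Time \<open>k\<close> occurs in both conditions, so both
  sides vanish when \<open>t k\<close> is outside \<open>B\<close>.\<close>

lemma emeasure_chain_cylinder_stay: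
  fixes A :: "real ^ 's ^ 's::finite"
  assumes "transition_matrix A"
  shows "emeasure (chain A s) {\<omega>. (\<forall>i\<le>k. \<omega> i = t i) \<and> (\<forall>i\<le>n. \<omega> (k + i) \<in> B)} =
    emeasure (chain A s) {\<omega>. \<forall>i\<le>k. \<omega> i = t i} * stay_prob A B n (t k)"
proof (induction n arbitrary: k t)
  case 0
  have "{\<omega>. (\<forall>i\<le>k. \<omega> i = t i) \<and> (\<forall>i\<le>0. \<omega> (k + i) \<in> B)} =
      (if t k \<in> B then {\<omega>. \<forall>i\<le>k. \<omega> i = t i} else {})"
    by auto
  then show ?case by simp
next
  case (Suc n)
  let ?E = "\<lambda>k t n. {\<omega>. (\<forall>i\<le>k. \<omega> i = t i) \<and> (\<forall>i\<le>n. \<omega> (k + i) \<in> B)}"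
  show ?case
  proof (cases "t k \<in> B")
    case False
    then have "?E k t (Suc n) = {}"
      by (auto dest!: spec[of _ k] spec[of _ 0])
    then show ?thesis using False by (simp only:) simp
  next
    case True
    let ?t = "\<lambda>s'. t(Suc k := s')"
    have "?E k t (Suc n) = (\<Union>s'\<in>UNIV. ?E (Suc k) (?t s') n)"
    proof (intro set_eqI iffI)
      fix \<omega> assume \<omega>: "\<omega> \<in> ?E k t (Suc n)"
      then have "\<omega> (Suc k + i) \<in> B" if "i \<le> n" for i
        using that by (auto dest!: spec[of _ "Suc i"])
      with \<omega> have "\<omega> \<in> ?E (Suc k) (?t (\<omega> (Suc k))) n"
        by (auto simp: le_Suc_eq)
      then show "\<omega> \<in> (\<Union>s'\<in>UNIV. ?E (Suc k) (?t s') n)" by blast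
    next
      fix \<omega> assume "\<omega> \<in> (\<Union>s'\<in>UNIV. ?E (Suc k) (?t s') n)"
      then obtain s' where \<omega>: "\<omega> \<in> ?E (Suc k) (?t s') n" by blast
      then have t: "\<omega> i = t i" if "i \<le> k" for i
        using that by (auto dest!: spec[of _ i])
      have "\<omega> (k + i) \<in> B" if "i \<le> Suc n" for i
        using that \<omega> t[of k] True by (cases i) auto
      with t show "\<omega> \<in> ?E k t (Suc n)" by auto
    qed
    then have "emeasure (chain A s) (?E k t (Suc n)) =
        emeasure (chain A s) (\<Union>s'\<in>UNIV. ?E (Suc k) (?t s') n)"
      by (simp only:)
    also have "\<dots> = (\<Sum>s'\<in>UNIV. emeasure (chain A s) (?E (Suc k) (?t s') n))"
    proof (rule sum_emeasure[symmetric])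
      show "disjoint_family (\<lambda>s'. ?E (Suc k) (?t s') n)"
        by (auto simp: disjoint_family_on_def)
      show "range (\<lambda>s'. ?E (Suc k) (?t s') n) \<subseteq> sets (chain A s)"
        by (intro image_subsetI sets_chain_intros)
    qed simp
    also have "\<dots> = (\<Sum>s'\<in>UNIV. emeasure (chain A s) {\<omega>. \<forall>i\<le>k. \<omega> i = t i} *
        (ennreal (A $ t k $ s') * stay_prob A B n s'))"
    proof (rule sum.cong[OF refl])
      fix s'
      have "emeasure (chain A s) {\<omega>. \<forall>i\<le>Suc k. \<omega> i = ?t s' i} =
          emeasure (chain A s) {\<omega>. \<forall>i\<le>k. \<omega> i = t i} * ennreal (A $ t k $ s')"
        unfolding emeasure_chain_cylinder[OF assms]
        by (simp add: ennreal_mult prod_nonneg transition_matrix_nonneg[OF assms])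
      then show "emeasure (chain A s) (?E (Suc k) (?t s') n) =
          emeasure (chain A s) {\<omega>. \<forall>i\<le>k. \<omega> i = t i} * (ennreal (A $ t k $ s') * stay_prob A B n s')"
        unfolding Suc.IH by (simp add: mult.assoc)
    qed
    finally show ?thesis
      using True by (simp add: sum_distrib_left)
  qed
qed

text \<open>The chain starts in \<open>s\<close> almost surely, so the case \<open>k = 0\<close> of
  the product formula applies with a cylinder of probability 1.\<close>

lemma emeasure_chain_stay:
  fixes A :: "real ^ 's ^ 's::finite"
  assumes "transition_matrix A"
  shows "emeasure (chain A s) {\<omega>. \<forall>i\<le>n. \<omega> i \<in> B} = stay_prob A B n s"
proof -
  interpret prob_space "chain A s" by (rule prob_space_chain)
  have start: "emeasure (chain A s) {\<omega>. \<omega> 0 = s} = 1"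
    using emeasure_chain_cylinder[OF assms, of s 0 "\<lambda>_. s"] by simp
  have [measurable]: "{\<omega>. \<omega> 0 = s} \<in> sets (chain A s)"
    "{\<omega>. \<forall>i\<le>n. \<omega> i \<in> B} \<in> sets (chain A s)"
    "{\<omega>. \<omega> 0 = s \<and> (\<forall>i\<le>n. \<omega> i \<in> B)} \<in> sets (chain A s)"
    by (intro sets_chain_intros)+
  have "AE \<omega> in chain A s. \<omega> \<in> {\<omega>. \<omega> 0 = s}"
    using start by (subst AE_in_set_eq_1) (simp_all add: emeasure_eq_measure)
  then have "AE \<omega> in chain A s. \<omega> 0 = s" by simp
  then have "emeasure (chain A s) {\<omega>. \<forall>i\<le>n. \<omega> i \<in> B} =
      emeasure (chain A s) {\<omega>. \<omega> 0 = s \<and> (\<forall>i\<le>n. \<omega> i \<in> B)}"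
    by (intro emeasure_eq_AE) auto
  also have "\<dots> = stay_prob A B n s"
    using emeasure_chain_cylinder_stay[OF assms, of s 0 "\<lambda>_. s" n B] start by simp
  finally show ?thesis .
qed

section \<open>Expected meeting time as a tail sum and as a least fixed point\<close>

lemma meeting_time_gt_iff: "enat n < meeting_time \<omega> \<longleftrightarrow> (\<forall>i\<le>n. \<omega> i \<in> - diagonal)"
proof -
  have "enat n < meeting_time \<omega> \<longleftrightarrow> eSuc (enat n) \<le> meeting_time \<omega>"
    by (simp add: ileI1 Suc_ile_eq eSuc_enat)
  also have "\<dots> \<longleftrightarrow> (\<forall>i\<le>n. fst (\<omega> i) \<noteq> snd (\<omega> i))"
    unfolding meeting_time_def le_Inf_iff eSuc_enat by (force simp: not_less_eq_eq[symmetric])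
  finally show ?thesis
    by (simp add: diagonal_def) (metis prod.collapse fst_conv snd_conv)
qed

text \<open>Counting the naturals below \<open>x\<close>; integrated over trajectories, this
  expresses the expected meeting time as the sum of its tail probabilities.\<close>

lemma ennreal_of_enat_eq_suminf:
  "ennreal_of_enat x = (\<Sum>n. of_bool (enat n < x))"
proof (cases x)
  case (enat k)
  then have "(\<Sum>n. of_bool (enat n < x) :: ennreal) = (\<Sum>n<k. 1)"
    by (subst suminf_finite[of "{..<k}"]) auto
  then show ?thesis using enat by simp
next
  case infinity
  have "(\<Sum>n. 1 :: ennreal) = top"
    by (simp add: suminf_eq_SUP ennreal_SUP_of_nat_eq_top)
  then show ?thesis using infinity by simp
qed

lemma expected_meeting_time_eq_suminf:
  assumes "transition_matrix \<Delta>"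
  shows "expected_meeting_time \<Delta> w = (\<Sum>n. stay_prob \<Delta> (- diagonal) n w)"
proof -
  let ?E = "\<lambda>n. {\<omega>. \<forall>i\<le>n. \<omega> i \<in> - diagonal}"
  have E: "?E n \<in> sets (chain \<Delta> w)" for n
    by (intro sets_chain_intros)
  have "expected_meeting_time \<Delta> w = (\<integral>\<^sup>+\<omega>. (\<Sum>n. indicator (?E n) \<omega>) \<partial>chain \<Delta> w)"
    unfolding expected_meeting_time_def ennreal_of_enat_eq_suminf
    by (simp only: meeting_time_gt_iff indicator_def mem_Collect_eq)
  also have "\<dots> = (\<Sum>n. \<integral>\<^sup>+\<omega>. indicator (?E n) \<omega> \<partial>chain \<Delta> w)"
    by (intro nn_integral_suminf borel_measurable_indicator E)
  also have "\<dots> = (\<Sum>n. emeasure (chain \<Delta> w) (?E n))"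
    by (simp only: nn_integral_indicator[OF E])
  finally show ?thesis
    by (simp only: emeasure_chain_stay[OF assms])
qed

lemma expected_meeting_time_eq_lfp:
  assumes "transition_matrix \<Delta>"
  shows "expected_meeting_time \<Delta> = lfp (meeting_operator {\<Delta>})"
proof -
  \<comment> \<open>The iterates from \<open>bot\<close> are the partial sums of the tail series:
    the indicator contributes the term for time 0, and one application of the operator shifts the
    remaining terms by one.\<close>
  have "(meeting_operator {\<Delta>} ^^ n) bot = (\<lambda>w. \<Sum>i<n. stay_prob \<Delta> (- diagonal) i w)" for n
  proof (induction n)
    case (Suc n)
    have "(\<Sum>i<n. \<Sum>s'\<in>UNIV. ennreal (\<Delta> $ w $ s') * stay_prob \<Delta> (- diagonal) i s') =
        (\<Sum>s'\<in>UNIV. ennreal (\<Delta> $ w $ s') * (\<Sum>i<n. stay_prob \<Delta> (- diagonal) i s'))" for w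
      by (subst sum.swap) (simp add: sum_distrib_left)
    then show ?case
      unfolding funpow.simps comp_def Suc
      by (simp add: meeting_operator_def upper_transition_operator_singleton fun_eq_iff
          sum.lessThan_Suc_shift flip: sum_distrib_left del: sum.lessThan_Suc)
  qed (simp add: fun_eq_iff bot_ennreal)
  then show ?thesis
    by (simp add: sup_continuous_lfp[OF sup_continuous_meeting_operator] fun_eq_iff
        expected_meeting_time_eq_suminf[OF assms] suminf_eq_SUP image_comp)
qed


section \<open>Stationary chains attain the least fixed point\<close>

text \<open>Iterating the subsolution inequality gains a factor \<open>c\<close> on the uniform
  bound \<open>B\<close> each time, and this error tends to 0. The expected meeting time may be
  infinite, since only \<open>v\<close> has to be bounded.\<close>

lemma strict_subsolution_le_expected_meeting_time:
  assumes "transition_matrix \<Delta>" and "c < 1" and "B < top" and "\<And>w. v w \<le> B"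
    and v: "v \<le> meeting_operator {\<Delta>} (\<lambda>w. c * v w)"
  shows "v \<le> expected_meeting_time \<Delta>"
proof -
  let ?h = "expected_meeting_time \<Delta>"
  have h: "?h = meeting_operator {\<Delta>} ?h"
    unfolding expected_meeting_time_eq_lfp[OF assms(1)]
    by (rule lfp_unfold[OF mono_meeting_operator])
  have bound: "v w \<le> ?h w + c ^ n * B" for n w
  proof (induction n arbitrary: w)
    case 0
    then show ?case using assms(4)[of w] by (simp add: add_increasing)
  next
    case (Suc n)
    let ?U = "\<lambda>f. upper_transition_operator {\<Delta>} f w"
    have "?U (\<lambda>w. c * v w) \<le> ?U (\<lambda>w. ?h w + c ^ Suc n * B)"
    proof (intro upper_transition_operator_mono order_refl le_funI)
      fix x
      have "c * v x \<le> c * (?h x + c ^ n * B)"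
        by (intro mult_left_mono Suc) simp
      also have "\<dots> \<le> 1 * ?h x + c ^ Suc n * B"
        unfolding distrib_left using assms(2) by (intro add_mono mult_right_mono) (auto simp: mult.assoc)
      finally show "c * v x \<le> ?h x + c ^ Suc n * B" by simp
    qed
    \<comment> \<open>The constant passes through unchanged because the rows of
      \<open>\<Delta>\<close> sum to 1.\<close>
    also have "\<dots> = ?U ?h + c ^ Suc n * B"
      by (simp add: upper_transition_operator_singleton distrib_left sum.distrib
          transition_matrix_row_sum[OF assms(1)]
          flip: sum_distrib_right)
    finally have *: "?U (\<lambda>w. c * v w) \<le> ?U ?h + c ^ Suc n * B" .
    have "v w \<le> meeting_operator {\<Delta>} (\<lambda>w. c * v w) w"
      using v by (rule le_funD)
    also have "\<dots> \<le> meeting_operator {\<Delta>} ?h w + c ^ Suc n * B"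
      using * by (cases "w \<in> diagonal") (auto simp: meeting_operator_def add.assoc)
    finally show ?case
      using h by simp
  qed
  show ?thesis
  proof (rule le_funI)
    fix w
    \<comment> \<open>Both \<open>c\<close> and \<open>B\<close> are finite, so the limit of the
      error can be taken in the reals.\<close>
    obtain r where r: "c = ennreal r" "0 \<le> r" "r < 1"
      using assms(2) by (cases c) (auto simp: ennreal_less_one_iff)
    obtain b where b: "B = ennreal b" "0 \<le> b"
      using assms(3) by (cases B) auto
    have "(\<lambda>n. r ^ n * b) \<longlonglongrightarrow> 0 * b"
      by (intro tendsto_intros LIMSEQ_power_zero) (use r in auto)
    then have "(\<lambda>n. ennreal (r ^ n * b)) \<longlonglongrightarrow> ennreal 0"
      by (intro tendsto_ennrealI) simp
    then have "(\<lambda>n. c ^ n * B) \<longlonglongrightarrow> 0"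
      using r b by (simp add: ennreal_power ennreal_mult)
    then have "(\<lambda>n. ?h w + c ^ n * B) \<longlonglongrightarrow> ?h w + 0"
      by (intro tendsto_add tendsto_const)
    then show "v w \<le> ?h w"
      using LIMSEQ_le_const[of _ "?h w" "v w"] bound[where w = w] by simp
  qed
qed

section \<open>Row selection and discounted subsolutions\<close>

text \<open>Rectangularity, as in robust Markov decision processes: choices made separately in each
  state combine to one member of the set.\<close>

definition row_selectable :: "(real ^ 's ^ 's::finite) set \<Rightarrow> bool" where
  "row_selectable \<D> \<longleftrightarrow> (\<forall>\<Phi>. (\<forall>s. \<Phi> s \<in> \<D>) \<longrightarrow> (\<chi> s. \<Phi> s $ s) \<in> \<D>)"

lemma row_selectable_pair_set:
  fixes \<T> :: "(real ^ 'z ^ 'z::finite) set"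
  assumes "separately_specified_rows \<T>"
  shows "row_selectable (pair_set \<T>)"
  unfolding row_selectable_def
proof (intro allI impI)
  obtain R where R: "\<T> = {T. transition_matrix T \<and> (\<forall>z. T $ z \<in> R z)}"
    using assms by (auto simp: separately_specified_rows_def)
  fix \<Phi> :: "'z \<times> 'z \<Rightarrow> real ^ ('z \<times> 'z) ^ ('z \<times> 'z)"
  assume \<Phi>: "\<forall>s. \<Phi> s \<in> pair_set \<T>"
  have "\<exists>T S. \<Phi> s = pair_matrix T S \<and> (\<forall>y. T y \<in> \<T>) \<and> (\<forall>x. S x \<in> \<T>)" for s
    using \<Phi>[rule_format, of s] unfolding pair_set_def by blast
  then obtain T S where TS: "\<And>s. \<Phi> s = pair_matrix (T s) (S s)"
      "\<And>s y. T s y \<in> \<T>" "\<And>s x. S s x \<in> \<T>"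
    by metis
  \<comment> \<open>Row \<open>(x, y)\<close> of a pair matrix involves only row \<open>x\<close> of
    the first family at index \<open>y\<close> and row \<open>y\<close> of the second at index
    \<open>x\<close>. These rows are taken from the families chosen for \<open>(x, y)\<close>;
    separate specification of rows keeps the assembled matrices in \<open>\<T>\<close>.\<close>
  let ?T = "\<lambda>y. \<chi> x. T (x, y) y $ x" and ?S = "\<lambda>x. \<chi> y. S (x, y) x $ y"
  have "(\<chi> s. \<Phi> s $ s) = pair_matrix ?T ?S"
    by (simp add: TS(1) pair_matrix_def vec_eq_iff)
  moreover have "?T y \<in> \<T>" "?S y \<in> \<T>" for y
    using TS(2,3) by (auto simp: R transition_matrix_def)
  ultimately show "(\<chi> s. \<Phi> s $ s) \<in> pair_set \<T>"
    unfolding pair_set_def by blast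
qed

text \<open>Raising the discount from \<open>b\<close> to \<open>c\<close> compensates for suprema
  that need not be attained, so one matrix with nearly optimal rows inherits the subsolution
  inequality.\<close>

lemma subsolution_le_upper_expected_meeting_time:
  assumes tm: "\<And>\<Delta>. \<Delta> \<in> \<D> \<Longrightarrow> transition_matrix \<Delta>" and "row_selectable \<D>" and "\<D> \<noteq> {}"
    and "b < 1" and fin: "\<And>w. v w < top"
    and v: "v \<le> meeting_operator \<D> (\<lambda>w. b * v w)"
  shows "v \<le> upper_expected_meeting_time \<D>"
proof -
  obtain c where c: "b < c" "c < 1"
    using dense[OF assms(4)] by blast
  define B where "B = (\<Sum>w\<in>UNIV. v w)"
  have B: "B < top" "v w \<le> B" for w
    using fin by (auto simp: B_def intro: member_le_sum)
  let ?U = "\<lambda>\<D> w. upper_transition_operator \<D> v w"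
  have "\<exists>\<Delta>\<in>\<D>. b * ?U \<D> w \<le> c * ?U {\<Delta>} w" for w
  \<comment> \<open>A positive finite supremum makes the inequality between the \<open>b\<close> and
    \<open>c\<close> multiples strict, so some member exceeds the smaller one. If the supremum is 0,
    any member will do.\<close>
  proof (cases "?U \<D> w = 0")
    case False
    have "?U \<D> w \<le> B"
      by (rule upper_transition_operator_le_const[OF tm B(2)])
    then have "?U \<D> w < top"
      using B(1) by (rule le_less_trans)
    then have "b * ?U \<D> w < c * ?U \<D> w"
      using c False by (intro ennreal_mult_strict_right_mono) (auto simp: zero_less_iff_neq_zero)
    also have "c * ?U \<D> w = (SUP \<Delta>\<in>\<D>. c * ?U {\<Delta>} w)"
      unfolding upper_transition_operator_def by (simp add: SUP_mult_left_ennreal)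
    finally show ?thesis
      unfolding less_SUP_iff by (blast intro: less_imp_le)
  qed (use assms(3) in auto)
  then obtain \<Phi> where \<Phi>: "\<And>w. \<Phi> w \<in> \<D>" "\<And>w. b * ?U \<D> w \<le> c * ?U {\<Phi> w} w"
    by metis
  define \<Delta> where "\<Delta> = (\<chi> w. \<Phi> w $ w)"
  have \<Delta>: "\<Delta> \<in> \<D>"
    using assms(2) \<Phi>(1) by (auto simp: row_selectable_def \<Delta>_def)
  have "?U {\<Phi> w} w = ?U {\<Delta>} w" for w
    by (simp add: upper_transition_operator_singleton \<Delta>_def)
  then have le: "b * ?U \<D> w \<le> c * ?U {\<Delta>} w" for w
    using \<Phi>(2) by simp
  have "meeting_operator \<D> (\<lambda>w. b * v w) \<le> meeting_operator {\<Delta>} (\<lambda>w. c * v w)"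
    unfolding meeting_operator_def upper_transition_operator_cmult
    by (intro le_funI add_left_mono mult_left_mono le) simp
  with v have "v \<le> meeting_operator {\<Delta>} (\<lambda>w. c * v w)"
    by (rule order_trans)
  then have "v \<le> expected_meeting_time \<Delta>"
    by (intro strict_subsolution_le_expected_meeting_time[OF tm[OF \<Delta>] c(2) B])
  then show ?thesis
    using \<Delta> unfolding upper_expected_meeting_time_def le_fun_def
    by (blast intro: SUP_upper2)
qed

section \<open>Iterates of the operator and their discounted versions\<close>

lemma meeting_operator_le_const:
  assumes "\<And>\<Delta>. \<Delta> \<in> \<D> \<Longrightarrow> transition_matrix \<Delta>" and "\<And>w. f w \<le> c"
  shows "meeting_operator \<D> f w \<le> 1 + c"
  using upper_transition_operator_le_const[of \<D> f c w, OF assms]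
  by (cases "w \<in> diagonal") (auto simp: meeting_operator_def)

text \<open>It suffices to bound \<open>a\<close> times the iterate for every \<open>a < 1\<close>.
  This loss pays for discounting each of the \<open>n\<close> steps by a factor
  \<open>b\<close>.\<close>

lemma meeting_operator_iterate_le_upper_expected_meeting_time:
  assumes tm: "\<And>\<Delta>. \<Delta> \<in> \<D> \<Longrightarrow> transition_matrix \<Delta>" and "row_selectable \<D>" and "\<D> \<noteq> {}"
  shows "(meeting_operator \<D> ^^ n) bot w \<le> upper_expected_meeting_time \<D> w"
proof (rule ennreal_approx_unit)
  fix a :: ennreal assume "0 < a" "a < 1"
  then obtain r where r: "a = ennreal r" "0 < r" "r < 1"
    by (cases a) (auto simp: ennreal_less_one_iff)
  \<comment> \<open>The root of order \<open>Suc n\<close> rather than \<open>n\<close> gives a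
    \<open>b < 1\<close> with \<open>b ^ n \<ge> a\<close> also for \<open>n = 0\<close>.\<close>
  define b where "b = ennreal (root (Suc n) r)"
  have b: "b < 1" "b ^ n \<ge> a"
  proof -
    have q: "0 < root (Suc n) r" "root (Suc n) r < 1"
      using r by (simp_all add: real_root_lt_1_iff)
    then show "b < 1" by (simp add: b_def ennreal_less_one_iff)
    have "r = root (Suc n) r ^ Suc n"
      using r by (intro real_root_pow_pos2[symmetric]) auto
    also have "\<dots> \<le> root (Suc n) r ^ n"
      using q by (intro power_decreasing) auto
    finally show "b ^ n \<ge> a"
      using q r by (simp add: b_def ennreal_power ennreal_leI)
  qed
  let ?F = "meeting_operator \<D>" and ?G = "\<lambda>f. meeting_operator \<D> (\<lambda>w. b * f w)"
  have G: "mono ?G"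
    by (intro monoI meeting_operator_mono) (auto simp: le_fun_def intro: mult_left_mono)
  \<comment> \<open>Each step adds at most 1, which gives the finiteness required of a
    subsolution.\<close>
  have fin: "(?G ^^ k) bot w \<le> of_nat k" for k w
  proof (induction k arbitrary: w)
    case (Suc k)
    have "b * (?G ^^ k) bot w \<le> 1 * of_nat k" for w
      using b(1) by (intro mult_mono Suc) auto
    then have "?G ((?G ^^ k) bot) w \<le> 1 + of_nat k"
      by (intro meeting_operator_le_const[OF tm]) simp_all
    then show ?case
      by (simp only: funpow.simps comp_apply of_nat_Suc)
  qed (simp add: bot_ennreal)
  have "(?G ^^ n) bot \<le> upper_expected_meeting_time \<D>"
  proof (rule subsolution_le_upper_expected_meeting_time[OF assms b(1)])
    show "(?G ^^ n) bot w < top" for w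
      using fin[of n w] by (rule le_less_trans) (simp add: ennreal_of_nat_eq_real_of_nat)
    \<comment> \<open>Iterates of a monotone operator from \<open>bot\<close> increase, so each of
      them is a subsolution.\<close>
    have "(?G ^^ n) bot \<le> (?G ^^ Suc n) bot"
      using funpow_mono[OF G bot_least, of n "?G bot"]
      by (simp only: funpow_Suc_right comp_def)
    then show "(?G ^^ n) bot \<le> ?G ((?G ^^ n) bot)" by simp
  qed
  \<comment> \<open>Of the factor \<open>b ^ Suc k\<close>, the constant term 1 only decreases,
    while in the other term \<open>b ^ k\<close> is absorbed by the induction hypothesis and the
    last \<open>b\<close> is the discount in \<open>?G\<close>.\<close>
  moreover have "b ^ k * (?F ^^ k) bot w \<le> (?G ^^ k) bot w" for k w
  proof (induction k arbitrary: w)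
    case (Suc k)
    define f g where fg: "f = (?F ^^ k) bot" "g = (?G ^^ k) bot"
    let ?U = "\<lambda>f. upper_transition_operator \<D> f w"
    have "b ^ k * ?U f \<le> ?U g"
      unfolding upper_transition_operator_cmult[symmetric] fg
      by (intro upper_transition_operator_mono order_refl le_funI Suc.IH)
    then have "b * (b ^ k * ?U f) \<le> b * ?U g"
      by (rule mult_left_mono) simp
    moreover have "b ^ Suc k \<le> 1"
      using b(1) by (intro power_le_one) auto
    ultimately show ?case
      unfolding funpow.simps comp_apply fg[symmetric]
      by (cases "w \<in> diagonal")
        (auto simp: meeting_operator_def upper_transition_operator_cmult distrib_left mult.assoc
          intro!: add_mono)
  qed (simp add: bot_ennreal)
  moreover have "a * (?F ^^ n) bot w \<le> b ^ n * (?F ^^ n) bot w"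
    using b(2) by (rule mult_right_mono) simp
  ultimately show "a * (?F ^^ n) bot w \<le> upper_expected_meeting_time \<D> w"
    by (meson le_funD order_trans)
qed

section \<open>The upper expected meeting time as a least fixed point\<close>

text \<open>The operator of a single member lies below that of the whole set, and least fixed points
  are monotone in the operator.\<close>

lemma upper_expected_meeting_time_le_lfp:
  assumes "\<And>\<Delta>. \<Delta> \<in> \<D> \<Longrightarrow> transition_matrix \<Delta>"
  shows "upper_expected_meeting_time \<D> \<le> lfp (meeting_operator \<D>)"
  unfolding upper_expected_meeting_time_def
  by (intro le_funI SUP_least)
    (auto simp: expected_meeting_time_eq_lfp assms intro!: le_funD[OF lfp_mono] meeting_operator_mono)

lemma upper_expected_meeting_time_eq_lfp:
  assumes "\<And>\<Delta>. \<Delta> \<in> \<D> \<Longrightarrow> transition_matrix \<Delta>" and "row_selectable \<D>" and "\<D> \<noteq> {}"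
  shows "upper_expected_meeting_time \<D> = lfp (meeting_operator \<D>)"
proof (rule antisym)
  show "lfp (meeting_operator \<D>) \<le> upper_expected_meeting_time \<D>"
    unfolding sup_continuous_lfp[OF sup_continuous_meeting_operator]
    by (intro SUP_least le_funI meeting_operator_iterate_le_upper_expected_meeting_time assms)
qed (rule upper_expected_meeting_time_le_lfp[OF assms(1)])

theorem mainTheorem3:
  fixes \<T> :: "(real ^ 'z ^ 'z::finite) set"
  assumes "CARD('z) \<ge> 2"
    and "\<T> \<noteq> {}"
    and "compact \<T>"
    and "convex \<T>"
    and "\<forall>T\<in>\<T>. transition_matrix T"
    and "separately_specified_rows \<T>"
  shows "(\<forall>w. upper_expected_meeting_time (pair_set \<T>) w =
              upper_expected_meeting_time (convex hull (pair_set \<T>)) w) \<and>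
         meeting_equation \<T> (upper_expected_meeting_time (pair_set \<T>)) \<and>
         (\<forall>m. meeting_equation \<T> m \<longrightarrow>
              (\<forall>w. upper_expected_meeting_time (pair_set \<T>) w \<le> m w))"
proof -
  let ?P = "pair_set \<T>" and ?C = "convex hull (pair_set \<T>)"
  have C: "\<And>\<Delta>. \<Delta> \<in> ?C \<Longrightarrow> transition_matrix \<Delta>"
    using transition_matrix_convex_hull_pair_set[OF assms(6)] .
  have P: "\<And>\<Delta>. \<Delta> \<in> ?P \<Longrightarrow> transition_matrix \<Delta>"
    by (intro C hull_inc)
  obtain T where "T \<in> \<T>"
    using assms(2) by blast
  then have "pair_matrix (\<lambda>_. T) (\<lambda>_. T) \<in> ?P"
    unfolding pair_set_def by blast
  then have ne: "?P \<noteq> {}"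
    by blast
  \<comment> \<open>The equation is stated with the hull, whereas rows are selected in the pair set;
    equality of the two operators lets the least fixed point be used for both.\<close>
  have op: "meeting_operator ?C = meeting_operator ?P"
    by (simp add: fun_eq_iff meeting_operator_def upper_transition_operator_convex_hull[OF P])
  have eq: "upper_expected_meeting_time ?P = lfp (meeting_operator ?C)"
    unfolding op by (rule upper_expected_meeting_time_eq_lfp[OF P row_selectable_pair_set[OF assms(6)] ne])
  have "upper_expected_meeting_time ?P = upper_expected_meeting_time ?C"
  proof (rule antisym)
    show "upper_expected_meeting_time ?P \<le> upper_expected_meeting_time ?C"
      unfolding upper_expected_meeting_time_def
      by (intro le_funI SUP_subset_mono hull_subset order_refl)
    \<comment> \<open>By \<open>eq\<close> the right-hand side is the least fixed point of the hull
      operator, which bounds the expected meeting time of every matrix in the hull.\<close>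
    show "upper_expected_meeting_time ?C \<le> upper_expected_meeting_time ?P"
      unfolding eq by (rule upper_expected_meeting_time_le_lfp[OF C])
  qed
  moreover have "meeting_equation \<T> m \<longleftrightarrow> meeting_operator ?C m = m" for m
    by (auto simp: meeting_equation_def meeting_operator_def fun_eq_iff)
  moreover have "lfp (meeting_operator ?C) \<le> m" if "meeting_operator ?C m = m" for m
    using that by (intro lfp_lowerbound) simp
  ultimately show ?thesis
    using lfp_fixpoint[OF mono_meeting_operator, of ?C] by (auto simp: eq le_fun_def)
qed

end
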